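(* The category $\mathcal{K}$ of pointed finite linear graphs (with the morphisms described in the context) is a projective Fraïssé family.
   Context: For an integer $n\ge 2$, $\langle n\rangle$ denotes the pointed finite linear graph with vertex set $\{0,1,\dots,n-1\}$, edge relation $R$ given by $(i,j)\in R \iff |i-j|\le 1$ (so there is a loop at every vertex), and designated zero-vertex $0$. Every pointed finite linear graph (a finite path with at least two vertices, loops at all vertices, and one designated end vertex called the zero-vertex) is isomorphic to some $\langle n\rangle$. An epimorphism between pointed finite linear graphs is a function taking edges to edges, surjective on vertices and on edges, and preserving the zero-vertex. $\mathcal{K}$ is the category whose objects are the pointed finite linear graphs and whose morphisms are all epimorphisms $f:\langle n\rangle\to\langle m\rangle$ for which there exist $0=i_0<i_1<\cdots<i_k=n-1$ such that (1) $f$ restricted to $[i_j,i_{j+1}]$ is either non-increasing or non-decreasing for $0\le j\le k-1$; (2) $f(i_j)=m-1$ for $j$ odd; (3) $f(i_j)=0$ for $j$ even. A class $\mathcal{F}$ of finite structures with a fixed family of morphisms is a projective Fraïssé family if: (1) $\mathcal{F}$ is a category: morphisms are closed under composition and the identity map on each structure is a morphism; (2) $\mathcal{F}$ contains countably many structures up to isomorphism; (3) for any $A,B\in\mathcal{F}$ there exist $C\in\mathcal{F}$ and morphisms $C\to A$ and $C\to B$; (4) for any $A,B,C\in\mathcal{F}$ and morphisms $f:B\to A$ and $g:C\to A$ there exist $D\in\mathcal{F}$ and morphisms $f':D\to B$ and $g':D\to C$ with $f\circ f'=g\circ g'$. *)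

theory Defs
  imports "HOL-Library.FuncSet" "HOL-Library.Countable_Set"
begin

text \<open>
  A class \<open>F\<close> of finite structures is given by its elements, their universes \<open>U A\<close>, the relation
  \<open>Iso\<close> of being isomorphic as structures, and for all \<open>A\<close>, \<open>B\<close> in \<open>F\<close> a set \<open>Mor A B\<close> of functions
  from \<open>U A\<close> to \<open>U B\<close>. Functions are extensional (undefined off the universe), so that
  equality of morphisms is equality in HOL and composition is \<^const>\<open>compose\<close>.
\<close>

definition projective_Fraisse_family ::
  "('s \<Rightarrow> 'v set) \<Rightarrow> ('s \<Rightarrow> 's \<Rightarrow> bool) \<Rightarrow> 's set \<Rightarrow> ('s \<Rightarrow> 's \<Rightarrow> ('v \<Rightarrow> 'v) set) \<Rightarrow> bool"
  where
  "projective_Fraisse_family U Iso F Mor \<longleftrightarrow>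
     (\<forall>A\<in>F. finite (U A)) \<and>
     (\<forall>A\<in>F. \<forall>B\<in>F. Mor A B \<subseteq> U A \<rightarrow>\<^sub>E U B) \<and>
     (\<forall>A\<in>F. \<forall>B\<in>F. \<forall>C\<in>F. \<forall>f\<in>Mor A B. \<forall>g\<in>Mor B C. compose (U A) g f \<in> Mor A C) \<and>
     (\<forall>A\<in>F. (\<lambda>x\<in>U A. x) \<in> Mor A A) \<and>
     (\<exists>S\<subseteq>F. countable S \<and> (\<forall>A\<in>F. \<exists>B\<in>S. Iso A B)) \<and>
     (\<forall>A\<in>F. \<forall>B\<in>F. \<exists>C\<in>F. Mor C A \<noteq> {} \<and> Mor C B \<noteq> {}) \<and>
     (\<forall>A\<in>F. \<forall>B\<in>F. \<forall>C\<in>F. \<forall>f\<in>Mor B A. \<forall>g\<in>Mor C A.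
        \<exists>D\<in>F. \<exists>f'\<in>Mor D B. \<exists>g'\<in>Mor D C. compose (U D) f f' = compose (U D) g g')"

record 'v pgraph =
  verts :: "'v set"
  edges :: "('v \<times> 'v) set"
  zero_vertex :: 'v

definition graph_iso :: "'a pgraph \<Rightarrow> 'b pgraph \<Rightarrow> ('a \<Rightarrow> 'b) \<Rightarrow> bool" where
  "graph_iso A B h \<longleftrightarrow>
     bij_betw h (verts A) (verts B) \<and> map_prod h h ` edges A = edges B \<and> h (zero_vertex A) = zero_vertex B"

definition graph_isomorphic :: "'a pgraph \<Rightarrow> 'b pgraph \<Rightarrow> bool" where
  "graph_isomorphic A B \<longleftrightarrow> (\<exists>h. graph_iso A B h)"

definition epimorphisms :: "'a pgraph \<Rightarrow> 'b pgraph \<Rightarrow> ('a \<Rightarrow> 'b) set" where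
  "epimorphisms A B = {f \<in> verts A \<rightarrow>\<^sub>E verts B.
     (\<forall>(x, y)\<in>edges A. (f x, f y) \<in> edges B) \<and>
     f ` verts A = verts B \<and>
     (\<forall>(u, v)\<in>edges B. \<exists>(x, y)\<in>edges A. f x = u \<and> f y = v) \<and>
     f (zero_vertex A) = zero_vertex B}"

definition std_graph :: "nat \<Rightarrow> nat pgraph"  (\<open>\<langle>_\<rangle>\<close>) where
  "\<langle>n\<rangle> = \<lparr>verts = {..<n},
          edges = {(i, j). i < n \<and> j < n \<and> \<bar>int i - int j\<bar> \<le> 1},
          zero_vertex = 0\<rparr>"

definition std_mor :: "nat \<Rightarrow> nat \<Rightarrow> (nat \<Rightarrow> nat) set" where
  "std_mor n m = {f \<in> epimorphisms \<langle>n\<rangle> \<langle>m\<rangle>. \<exists>k i.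
     i 0 = 0 \<and> (\<forall>j<k. i j < i (Suc j)) \<and> i k = n - 1 \<and>
     (\<forall>j<k. mono_on {i j..i (Suc j)} f \<or> antimono_on {i j..i (Suc j)} f) \<and>
     (\<forall>j\<le>k. odd j \<longrightarrow> f (i j) = m - 1) \<and>
     (\<forall>j\<le>k. even j \<longrightarrow> f (i j) = 0)}"

definition K_obj :: "'v pgraph set" where
  "K_obj = {A. \<exists>n\<ge>2. graph_isomorphic \<langle>n\<rangle> A}"

text \<open>
  The monotonicity conditions refer to \<open>\<langle>n\<rangle>\<close> and \<open>\<langle>m\<rangle>\<close>; for arbitrary pointed finite linear graphs
  they are read along the isomorphisms with these, which are unique because they fix the zero-vertex.
\<close>

definition K_mor :: "'v pgraph \<Rightarrow> 'v pgraph \<Rightarrow> ('v \<Rightarrow> 'v) set" where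
  "K_mor A B = {f \<in> epimorphisms A B.
     \<exists>n\<ge>2. \<exists>m\<ge>2. \<exists>a b. graph_iso \<langle>n\<rangle> A a \<and> graph_iso \<langle>m\<rangle> B b \<and>
       (\<exists>g\<in>std_mor n m. \<forall>i<n. f (a i) = b (g i))}"

end

theory Submission
  imports Defs
begin

text \<open>
  Everything rests on unfolding. A morphism $f$ from a path with $N$ edges to a path with $p$ edges
  walks up to the far end of the target, down to its zero-vertex, up again, and so on, and stops
  at one of the two ends. Counting the steps at which $f$ moves gives a nondecreasing map $F$ with
  steps $0$ or $1$ from $F(0) = 0$ to $F(N) = kp$, where $k$ is the number of laps, and $f$ is $F$
  followed by the triangle wave of period $2p$ (\<open>zigzag\<close>). Conversely every such $F$ with $k > 0$
  yields a morphism. So the breakpoints can be forgotten, and morphisms become monotone lifts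
  (\<open>std_mor_zigzag_lift\<close>, \<open>zigzag_lift_std_mor\<close>).

  A lift $G$ on $[0, p]$, say with $l$ laps over a path with $q$ edges, extends to the whole half
  line by reflecting it at the multiples of $p$ (\<open>reflect\<close>), and the extension $H$ satisfies
  $\mathrm{zigzag}_q \circ H = \mathrm{zigzag}_q \circ G \circ \mathrm{zigzag}_p$
  (\<open>zigzag_reflect\<close>). Hence $H \circ F$ is a lift of the composite, and it makes $kl$ laps: the
  morphisms are closed under composition.

  The same extension solves amalgamation. Let the lifts $F$ of $f$ and $G$ of $g$ make $k$ and $l$
  laps over the common target. Unroll the source of $f$ to $l$ copies and that of $g$ to $k$
  copies: both extended lifts are then monotone surjections onto the same path with $klp$ edges.
  Monotone surjections with unit steps have a pullback path, found by walking along one side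
  alone while its height stays constant and along both where both heights rise
  (\<open>unit_steps_pullback\<close>). The two coordinates of that path are lifts of the required morphisms.

  Every path maps to the path with a single edge, by the lift $F(i) = i$, so joint projection is
  amalgamation over this path. For arbitrary vertex sets, all of this is carried along the
  isomorphisms with the standard paths, which are unique (\<open>K_mor_iff\<close>).
\<close>

section \<open>Zigzags and their unfolding\<close>

text \<open>
  For $p > 0$, the distance from $x$ to the nearest multiple of $2p$.
\<close>
definition zigzag :: "nat \<Rightarrow> nat \<Rightarrow> nat" where
  "zigzag p x = (let y = x mod (2 * p) in if y \<le> p then y else 2 * p - y)"

definition unit_steps :: "nat \<Rightarrow> (nat \<Rightarrow> nat) \<Rightarrow> bool" where
  "unit_steps N F \<longleftrightarrow> F 0 = 0 \<and> (\<forall>i<N. F (Suc i) = F i \<or> F (Suc i) = Suc (F i))"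

text \<open>
  A lift with $k$ laps over a path with $p$ edges; at least one lap is made, so the whole target is
  covered.
\<close>
definition lap_lift :: "nat \<Rightarrow> nat \<Rightarrow> (nat \<Rightarrow> nat) \<Rightarrow> bool" where
  "lap_lift N p F \<longleftrightarrow> unit_steps N F \<and> (\<exists>k>0. F N = k * p)"

text \<open>
  For $p > 0$, the extension of a map $G$ on $[0,p]$, with $G(0) = 0$ and $G(p) = L$, that has point symmetry
  about $(p, L)$ and grows by $2L$ in each period $2p$.
\<close>
definition reflect :: "nat \<Rightarrow> nat \<Rightarrow> (nat \<Rightarrow> nat) \<Rightarrow> nat \<Rightarrow> nat" where
  "reflect p L G x = x div (2 * p) * (2 * L) +
     (let y = x mod (2 * p) in if y \<le> p then G y else 2 * L - G (2 * p - y))"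

text \<open>
  Allowing the offset $y = 2p$, where the two descriptions of the point agree, means that the step
  from $y$ to $y + 1$ never has to treat the passage into the next period separately. The same
  holds for \<open>reflect\<close> below.
\<close>
lemma zigzag_at:
  assumes "p > 0" "y \<le> 2 * p"
  shows "zigzag p (c * (2 * p) + y) = (if y \<le> p then y else 2 * p - y)"
proof (cases "y = 2 * p")
  case True
  then have "c * (2 * p) + y = Suc c * (2 * p)" by simp
  then have "(c * (2 * p) + y) mod (2 * p) = 0" by (metis mod_mult_self2_is_0)
  then show ?thesis using True assms by (simp add: zigzag_def)
next
  case False
  then have "(c * (2 * p) + y) mod (2 * p) = y" using assms by simp
  then show ?thesis by (simp add: zigzag_def)
qed

lemma reflect_at:
  assumes "p > 0" "y \<le> 2 * p" "G 0 = 0"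
  shows "reflect p L G (c * (2 * p) + y) =
    c * (2 * L) + (if y \<le> p then G y else 2 * L - G (2 * p - y))"
proof (cases "y = 2 * p")
  case True
  then have e: "c * (2 * p) + y = Suc c * (2 * p)" by simp
  then have "(c * (2 * p) + y) mod (2 * p) = 0" by (metis mod_mult_self2_is_0)
  moreover have "(c * (2 * p) + y) div (2 * p) = Suc c"
    unfolding e using assms(1) by (intro nonzero_mult_div_cancel_right) auto
  ultimately show ?thesis using True assms by (simp add: reflect_def)
next
  case False
  then have y: "y < 2 * p" using assms by simp
  then have "(c * (2 * p) + y) mod (2 * p) = y" by simp
  moreover have "(c * (2 * p) + y) div (2 * p) = c" using y assms(1) by simp
  ultimately show ?thesis by (simp add: reflect_def)
qed

lemma period_cases:
  fixes x p :: nat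
  assumes "p > 0"
  obtains c y where "x = c * (2 * p) + y" "y < 2 * p"
  using assms by (metis div_mod_decomp mod_less_divisor mult_pos_pos zero_less_numeral)

lemma zigzag_id: "x \<le> p \<Longrightarrow> zigzag p x = x"
  using zigzag_at[of p x 0] by (cases "p = 0") (auto simp: zigzag_def)

lemma zigzag_le: "p > 0 \<Longrightarrow> zigzag p x \<le> p"
  by (auto simp: zigzag_def Let_def)

lemma zigzag_lap:
  assumes "p > 0" "r \<le> p"
  shows "zigzag p (j * p + r) = (if even j then r else p - r)"
proof (cases "even j")
  case True
  then obtain c where "j = 2 * c" by blast
  then have "j * p + r = c * (2 * p) + r" by simp
  then show ?thesis using zigzag_at[of p r c] assms True by (metis trans_le_add1 mult_2)
next
  case False
  then obtain c where "j = 2 * c + 1" by (meson oddE)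
  then have "j * p + r = c * (2 * p) + (p + r)" by (simp add: algebra_simps)
  then have "zigzag p (j * p + r) = (if p + r \<le> p then p + r else 2 * p - (p + r))"
    using zigzag_at[of p "p + r" c] assms by (metis add_le_mono le_refl mult_2)
  then show ?thesis using assms False by auto
qed

lemma zigzag_Suc:
  assumes "p > 0"
  shows "zigzag p (Suc x) \<le> Suc (zigzag p x)" "zigzag p x \<le> Suc (zigzag p (Suc x))"
proof -
  obtain c y where "x = c * (2 * p) + y" "y < 2 * p" using period_cases[OF assms] .
  then show "zigzag p (Suc x) \<le> Suc (zigzag p x)" "zigzag p x \<le> Suc (zigzag p (Suc x))"
    using zigzag_at[of p y c] zigzag_at[of p "Suc y" c] assms by auto
qed

lemma zigzag_add_period: "zigzag q (c * (2 * (l * q)) + z) = zigzag q z"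
proof -
  have "c * (2 * (l * q)) + z = z + (c * l) * (2 * q)" by (simp add: algebra_simps)
  then have "(c * (2 * (l * q)) + z) mod (2 * q) = z mod (2 * q)" by (metis mod_mult_self1)
  then show ?thesis by (simp add: zigzag_def)
qed

text \<open>
  The triangle wave is even and $2lq$ is a multiple of its period. Truncated subtraction makes this
  the form that evenness takes on the natural numbers.
\<close>
lemma zigzag_reflection:
  assumes "q > 0" "z \<le> 2 * (l * q)"
  shows "zigzag q (2 * (l * q) - z) = zigzag q z"
proof -
  obtain c y where z: "z = c * (2 * q) + y" "y < 2 * q" using period_cases[OF assms(1)] .
  show ?thesis
  proof (cases "c < l")
    case True
    then obtain d where l: "l = c + Suc d" using less_iff_Suc_add by auto
    have "2 * (l * q) - z = d * (2 * q) + (2 * q - y)"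
      using z unfolding l by (simp add: algebra_simps)
    then show ?thesis
      using z zigzag_at[of q y c] zigzag_at[of q "2 * q - y" d] assms(1) by auto
  next
    case False
    then have "l * q \<le> c * q" by simp
    moreover have "c * (2 * q) = 2 * (c * q)" by simp
    ultimately have "y = 0" "2 * (l * q) - z = 0 * (2 * q) + 0" using z assms(2) by linarith+
    then show ?thesis using z zigzag_at[of q 0 c] zigzag_at[of q 0 0] assms(1) by simp
  qed
qed

lemma unit_steps_mono:
  assumes "unit_steps N F" "i \<le> j" "j \<le> N"
  shows "F i \<le> F j"
  using assms(2,3)
proof (induction j rule: dec_induct)
  case (step j)
  then show ?case using assms(1) unfolding unit_steps_def
    by (metis Suc_le_lessD le_SucI less_imp_le_nat)
qed simp

lemma unit_steps_hits:
  assumes "unit_steps N F" "v \<le> F N"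
  shows "\<exists>i\<le>N. F i = v"
  using assms
proof (induction N)
  case 0
  then show ?case by (auto simp: unit_steps_def)
next
  case (Suc N)
  have "unit_steps N F" using Suc.prems(1) by (auto simp: unit_steps_def)
  moreover have "F (Suc N) = F N \<or> F (Suc N) = Suc (F N)"
    using Suc.prems(1) by (auto simp: unit_steps_def)
  ultimately show ?case using Suc.IH Suc.prems(2) by (metis le_SucE le_SucI order_refl)
qed

text \<open>
  Surjectivity on non-loop edges needs more than attained values: some step must
  go from $v$ to $v + 1$.
\<close>
lemma unit_steps_crosses:
  assumes "unit_steps N F" "Suc v \<le> F N"
  shows "\<exists>i<N. F i = v \<and> F (Suc i) = Suc v"
  using assms
proof (induction N)
  case 0
  then show ?case by (auto simp: unit_steps_def)
next
  case (Suc N)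
  have "unit_steps N F" using Suc.prems(1) by (auto simp: unit_steps_def)
  moreover have "F (Suc N) = F N \<or> F (Suc N) = Suc (F N)"
    using Suc.prems(1) by (auto simp: unit_steps_def)
  ultimately show ?case using Suc.IH Suc.prems(2) by (metis le_SucE less_Suc_eq Suc_inject)
qed

lemma unit_steps_reflect:
  assumes "p > 0" "unit_steps p G" "G p = L"
  shows "unit_steps M (reflect p L G)"
proof -
  have G0: "G 0 = 0" using assms(2) by (simp add: unit_steps_def)
  have "reflect p L G (Suc x) = reflect p L G x \<or>
        reflect p L G (Suc x) = Suc (reflect p L G x)" for x
  proof -
    obtain c y where x: "x = c * (2 * p) + y" "y < 2 * p" using period_cases[OF assms(1)] .
    have r: "reflect p L G x = c * (2 * L) + (if y \<le> p then G y else 2 * L - G (2 * p - y))"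
      unfolding x(1) using reflect_at[of p y G L c] assms(1) x(2) G0 by simp
    have s: "reflect p L G (Suc x) =
        c * (2 * L) + (if Suc y \<le> p then G (Suc y) else 2 * L - G (2 * p - Suc y))"
      using reflect_at[of p "Suc y" G L c] assms(1) x G0 by simp
    consider "y < p" | "y \<ge> p" by linarith
    then show ?thesis
    proof cases
      case 1
      then have "G (Suc y) = G y \<or> G (Suc y) = Suc (G y)"
        using assms(2) by (auto simp: unit_steps_def)
      moreover have "y \<le> p" "Suc y \<le> p" using 1 by auto
      ultimately show ?thesis using r s by (elim disjE) simp_all
    next
      case 2
      \<comment> \<open>On the second half of a period the extension runs through \<open>G\<close> backwards,
        so its step at \<open>y\<close> is the step of \<open>G\<close> at the mirror point.\<close>
      define w where "w = 2 * p - Suc y"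
      have w: "w < p" "2 * p - y = Suc w" using 2 x(2) by (auto simp: w_def)
      have "G (Suc w) = G w \<or> G (Suc w) = Suc (G w)"
        using assms(2) w(1) by (auto simp: unit_steps_def)
      moreover have "G (Suc w) \<le> L"
        using unit_steps_mono[OF assms(2), of "Suc w" p] w(1) assms(3) by simp
      moreover have "reflect p L G x = c * (2 * L) + (2 * L - G (Suc w))"
        using r 2 w assms(3) by (cases "y = p") auto
      moreover have "reflect p L G (Suc x) = c * (2 * L) + (2 * L - G w)"
        using s 2 by (simp add: w_def)
      ultimately show ?thesis by auto
    qed
  qed
  moreover have "reflect p L G 0 = 0"
    using reflect_at[of p 0 G L 0] assms(1) G0 by simp
  ultimately show ?thesis by (auto simp: unit_steps_def)
qed

lemma reflect_lap_end:
  assumes "p > 0" "G 0 = 0" "G p = L"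
  shows "reflect p L G (k * p) = k * L"
proof (cases "even k")
  case True
  then obtain c where "k = 2 * c" by blast
  then show ?thesis using reflect_at[of p 0 G L c] assms by (simp add: algebra_simps)
next
  case False
  then obtain c where "k = 2 * c + 1" by (meson oddE)
  then show ?thesis using reflect_at[of p p G L c] assms by (simp add: algebra_simps)
qed

text \<open>
  Folding the argument back into $[0,p]$ corresponds to a translation or a point reflection of the
  value, and $\mathrm{zigzag}_q$ is insensitive to both because $G(p)$ is a multiple of $q$.
  This is where it matters that a morphism ends at an end of its target.
\<close>
lemma zigzag_reflect:
  assumes "p > 0" "q > 0" "unit_steps p G" "G p = l * q"
  shows "zigzag q (reflect p (l * q) G x) = zigzag q (G (zigzag p x))"
proof -
  obtain c y where x: "x = c * (2 * p) + y" "y < 2 * p" using period_cases[OF assms(1)] .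
  have "G (2 * p - y) \<le> 2 * (l * q)" if "\<not> y \<le> p"
  proof -
    have "G (2 * p - y) \<le> l * q"
      using unit_steps_mono[OF assms(3), of "2 * p - y" p] that assms(4) by simp
    then show ?thesis by linarith
  qed
  then show ?thesis
    using x reflect_at[of p y G "l * q" c] zigzag_at[of p y c] assms
    by (auto simp: zigzag_add_period zigzag_reflection unit_steps_def)
qed

lemma lap_lift_comp:
  assumes "p > 0" "q > 0" "lap_lift N p F" "lap_lift p q G"
  obtains H where "lap_lift N q H" "\<And>i. zigzag q (H i) = zigzag q (G (zigzag p (F i)))"
proof -
  obtain k where F: "unit_steps N F" "k > 0" "F N = k * p"
    using assms(3) by (auto simp: lap_lift_def)
  obtain l where G: "unit_steps p G" "l > 0" "G p = l * q"
    using assms(4) by (auto simp: lap_lift_def)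
  let ?R = "reflect p (l * q) G"
  have R: "unit_steps M ?R" for M using unit_steps_reflect[OF assms(1) G(1,3)] .
  have "unit_steps N (\<lambda>i. ?R (F i))"
    using F(1) R unfolding unit_steps_def by (metis lessI)
  moreover have "?R (F N) = (k * l) * q"
    using reflect_lap_end[of p G "l * q" k] assms(1) F(3) G by (simp add: unit_steps_def)
  ultimately have "lap_lift N q (\<lambda>i. ?R (F i))"
    using F(2) G(2) unfolding lap_lift_def by (metis nat_0_less_mult_iff)
  then show ?thesis using that zigzag_reflect[OF assms(1,2) G(1,3)] by blast
qed

lemma unit_steps_append:
  assumes "unit_steps d U" "x = U d \<or> x = Suc (U d)"
  shows "unit_steps (Suc d) (U(Suc d := x))"
  using assms by (auto simp: unit_steps_def less_Suc_eq)

text \<open>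
  The pair of endpoints is reached from an earlier pair with equal heights: if one of the maps
  stands still in its last step, undo that step alone, and otherwise undo both. At an argument $0$ the
  height is $0$, so the other map must stand still.
\<close>
lemma unit_steps_pullback:
  assumes "unit_steps a F" "unit_steps c G" "F a = G c"
  shows "\<exists>d U V. unit_steps d U \<and> unit_steps d V \<and> U d = a \<and> V d = c \<and>
    (\<forall>i\<le>d. F (U i) = G (V i))"
  using assms
proof (induction "a + c" arbitrary: a c rule: less_induct)
  case less
  have F0: "F 0 = 0" and G0: "G 0 = 0" using less.prems by (auto simp: unit_steps_def)
  have extend: ?case
    if "a' \<le> a" "c' \<le> c" "a' + c' < a + c" "a \<le> Suc a'" "c \<le> Suc c'" "F a' = G c'" for a' c'
  proof -
    have "unit_steps a' F" "unit_steps c' G"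
      using less.prems that by (auto simp: unit_steps_def)
    from less.hyps[OF that(3) this that(6)] obtain d U V where
      UV: "unit_steps d U" "unit_steps d V" "U d = a'" "V d = c'" "\<forall>i\<le>d. F (U i) = G (V i)"
      by blast
    have "unit_steps (Suc d) (U(Suc d := a))" "unit_steps (Suc d) (V(Suc d := c))"
      using unit_steps_append[OF UV(1), of a] unit_steps_append[OF UV(2), of c] UV(3,4) that
      by linarith+
    moreover have "\<forall>i\<le>Suc d. F ((U(Suc d := a)) i) = G ((V(Suc d := c)) i)"
      using UV(5) less.prems(3) by (auto simp: le_Suc_eq)
    ultimately show ?thesis by (metis fun_upd_same)
  qed
  have stepF: "F (Suc a') = F a' \<or> F (Suc a') = Suc (F a')" if "a = Suc a'" for a'
    using less.prems(1) that by (auto simp: unit_steps_def)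
  have stepG: "G (Suc c') = G c' \<or> G (Suc c') = Suc (G c')" if "c = Suc c'" for c'
    using less.prems(2) that by (auto simp: unit_steps_def)
  show ?case
  proof (cases a; cases c)
    assume "a = 0" "c = 0"
    then show ?thesis using F0 G0
      by (intro exI[of _ 0] exI[of _ "\<lambda>_. 0"]) (auto simp: unit_steps_def)
  next
    fix c' assume "a = 0" "c = Suc c'"
    then show ?thesis using extend[of 0 c'] stepG[of c'] less.prems(3) F0 by auto
  next
    fix a' assume "a = Suc a'" "c = 0"
    then show ?thesis using extend[of a' 0] stepF[of a'] less.prems(3) G0 by auto
  next
    fix a' c' assume ac: "a = Suc a'" "c = Suc c'"
    then consider "F a' = F a" | "G c' = G c" | "F a' = G c'"
      using stepF[of a'] stepG[of c'] less.prems(3) by auto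
    then show ?thesis
      using extend[of a' c] extend[of a c'] extend[of a' c'] ac less.prems(3) by cases auto
  qed
qed

text \<open>
  The extensions are taken up to $lb$ and $kc$ so that both reach the height $klp$. The pullback
  coordinates $U$ and $V$ end at these multiples of $b$ and $c$, so they are themselves lifts over
  the two sources, with $l$ and $k$ laps.
\<close>
lemma lap_lift_amalgamation:
  assumes "p > 0" "b > 0" "c > 0" "lap_lift b p F" "lap_lift c p G"
  obtains d U V where "d > 0" "lap_lift d b U" "lap_lift d c V"
    "\<And>i. i \<le> d \<Longrightarrow> zigzag p (F (zigzag b (U i))) = zigzag p (G (zigzag c (V i)))"
proof -
  obtain k where F: "unit_steps b F" "k > 0" "F b = k * p"
    using assms(4) by (auto simp: lap_lift_def)
  obtain l where G: "unit_steps c G" "l > 0" "G c = l * p"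
    using assms(5) by (auto simp: lap_lift_def)
  let ?F = "reflect b (k * p) F" and ?G = "reflect c (l * p) G"
  have 1: "unit_steps (l * b) ?F" "unit_steps (k * c) ?G"
    using unit_steps_reflect assms F G by blast+
  have "?F (l * b) = l * (k * p)" "?G (k * c) = k * (l * p)"
    using reflect_lap_end[of b F] reflect_lap_end[of c G] assms F G
    by (auto simp: unit_steps_def)
  then have "?F (l * b) = ?G (k * c)" by simp
  from unit_steps_pullback[OF 1 this] obtain d U V where
    UV: "unit_steps d U" "unit_steps d V" "U d = l * b" "V d = k * c"
      "\<forall>i\<le>d. ?F (U i) = ?G (V i)" by blast
  have "d \<noteq> 0" using UV(1,3) G(2) assms(2) by (auto simp: unit_steps_def intro!: gr0I)
  moreover have "lap_lift d b U" "lap_lift d c V"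
    using UV F G by (auto simp: lap_lift_def)
  moreover have "zigzag p (F (zigzag b (U i))) = zigzag p (G (zigzag c (V i)))" if "i \<le> d" for i
    using zigzag_reflect[OF assms(2,1) F(1,3), of "U i"] zigzag_reflect[OF assms(3,1) G(1,3), of "V i"]
      UV(5) that by simp
  ultimately show ?thesis using that by blast
qed

section \<open>Morphisms between standard graphs\<close>

lemma verts_std [simp]: "verts \<langle>Suc N\<rangle> = {..N}"
  by (auto simp: std_graph_def)

lemma edges_std: "(i, j) \<in> edges \<langle>Suc N\<rangle> \<longleftrightarrow> i \<le> N \<and> j \<le> N \<and> i \<le> Suc j \<and> j \<le> Suc i"
  by (auto simp: std_graph_def)

lemma edges_std_subset: "edges \<langle>n\<rangle> \<subseteq> verts \<langle>n\<rangle> \<times> verts \<langle>n\<rangle>"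
  by (auto simp: std_graph_def)

lemma zero_std [simp]: "zero_vertex \<langle>n\<rangle> = 0"
  by (simp add: std_graph_def)

lemma edges_std_cases:
  assumes "(i, j) \<in> edges \<langle>Suc N\<rangle>"
  obtains "i \<le> N" "j = i" | "j \<le> N" "j = Suc i" | "i \<le> N" "i = Suc j"
  using assms unfolding edges_std by linarith

lemma zigzag_lift_epimorphism:
  assumes "p > 0" "lap_lift N p F" "f \<in> extensional {..N}" "\<And>i. i \<le> N \<Longrightarrow> f i = zigzag p (F i)"
  shows "f \<in> epimorphisms \<langle>Suc N\<rangle> \<langle>Suc p\<rangle>"
proof -
  obtain k where F: "unit_steps N F" "k > 0" "F N = k * p"
    using assms(2) by (auto simp: lap_lift_def)
  have p: "p \<le> F N" using F by simp
  have F0: "F 0 = 0" using F(1) by (simp add: unit_steps_def)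
  have hit: "\<exists>i\<le>N. f i = u" if "u \<le> p" for u
    using unit_steps_hits[OF F(1), of u] p that assms(4) zigzag_id[OF that] by fastforce
  have cross: "\<exists>i<N. f i = u \<and> f (Suc i) = Suc u" if "Suc u \<le> p" for u
    using unit_steps_crosses[OF F(1), of u] p that assms(4) zigzag_id[of u p] zigzag_id[of "Suc u" p]
    by (metis Suc_leD Suc_leI le_trans less_imp_le_nat)
  have step: "f (Suc i) \<le> Suc (f i) \<and> f i \<le> Suc (f (Suc i))" if "Suc i \<le> N" for i
  proof -
    have "F (Suc i) = F i \<or> F (Suc i) = Suc (F i)" using F(1) that by (auto simp: unit_steps_def)
    then show ?thesis using zigzag_Suc[OF assms(1), of "F i"] assms(4) that by auto
  qed
  have le: "f i \<le> p" if "i \<le> N" for i using assms(4) zigzag_le[OF assms(1)] that by simp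
  have "(f i, f j) \<in> edges \<langle>Suc p\<rangle>" if "(i, j) \<in> edges \<langle>Suc N\<rangle>" for i j
    using that by (cases rule: edges_std_cases) (use le step in \<open>auto simp: edges_std\<close>)
  moreover have "\<exists>(x, y)\<in>edges \<langle>Suc N\<rangle>. f x = u \<and> f y = v" if "(u, v) \<in> edges \<langle>Suc p\<rangle>" for u v
    using that
  proof (cases rule: edges_std_cases)
    case 1
    then obtain i where "i \<le> N" "f i = u" using hit by blast
    then show ?thesis using 1 by (intro bexI[of _ "(i, i)"]) (auto simp: edges_std)
  next
    case 2
    then obtain i where "i < N" "f i = u" "f (Suc i) = v" using cross by blast
    then show ?thesis by (intro bexI[of _ "(i, Suc i)"]) (auto simp: edges_std)
  next
    case 3
    then obtain i where "i < N" "f i = v" "f (Suc i) = u" using cross by blast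
    then show ?thesis by (intro bexI[of _ "(Suc i, i)"]) (auto simp: edges_std)
  qed
  moreover have "f ` {..N} = {..p}" using hit le by (force simp: image_iff)
  moreover have "f 0 = 0" using assms(4) F0 zigzag_id[of 0 p] by simp
  moreover have "f \<in> {..N} \<rightarrow>\<^sub>E {..p}" using assms(3) le by (auto simp: PiE_def)
  ultimately show ?thesis by (auto simp: epimorphisms_def)
qed

text \<open>
  The breakpoints are arguments at which the lift has the heights $0, p, \dots, kp$; between two
  successive ones the triangle wave is monotone.
\<close>
lemma zigzag_lift_std_mor:
  assumes "p > 0" "lap_lift N p F" "f \<in> extensional {..N}" "\<And>i. i \<le> N \<Longrightarrow> f i = zigzag p (F i)"
  shows "f \<in> std_mor (Suc N) (Suc p)"
proof -
  obtain k where F: "unit_steps N F" "k > 0" "F N = k * p"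
    using assms(2) by (auto simp: lap_lift_def)
  have F0: "F 0 = 0" using F(1) by (simp add: unit_steps_def)
  \<comment> \<open>A height can be attained on an interval; the first and the last breakpoint must be
    the ends \<open>0\<close> and \<open>N\<close> of the source, while the others may be chosen freely.\<close>
  have "\<forall>j. \<exists>i. j \<le> k \<longrightarrow> i \<le> N \<and> F i = j * p \<and> (j = 0 \<longrightarrow> i = 0) \<and> (j = k \<longrightarrow> i = N)"
  proof
    fix j
    consider "j = 0" | "j = k" | "0 < j" "j < k" | "j > k" by linarith
    then show "\<exists>i. j \<le> k \<longrightarrow> i \<le> N \<and> F i = j * p \<and> (j = 0 \<longrightarrow> i = 0) \<and> (j = k \<longrightarrow> i = N)"
    proof cases
      case 3
      then have "j * p \<le> F N" using F(3) by simp
      then show ?thesis using unit_steps_hits[OF F(1)] 3 by blast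
    qed (use F F0 in auto)
  qed
  then obtain i where i: "\<And>j. j \<le> k \<Longrightarrow> i j \<le> N \<and> F (i j) = j * p \<and>
      (j = 0 \<longrightarrow> i j = 0) \<and> (j = k \<longrightarrow> i j = N)"
    by metis
  have less: "i j < i (Suc j)" if "j < k" for j
  proof (rule ccontr)
    assume "\<not> i j < i (Suc j)"
    then have "F (i (Suc j)) \<le> F (i j)"
      using unit_steps_mono[OF F(1), of "i (Suc j)" "i j"] i[of j] that by simp
    then show False using i[of j] i[of "Suc j"] that assms(1) by simp
  qed
  have lap: "mono_on {i j..i (Suc j)} f \<or> antimono_on {i j..i (Suc j)} f" if j: "j < k" for j
  proof -
    have "\<exists>r\<le>p. F t = j * p + r \<and> f t = (if even j then r else p - r)"
      if "t \<in> {i j..i (Suc j)}" for t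
    proof -
      have "t \<le> N" using that i[of "Suc j"] j by simp
      moreover from this have "j * p \<le> F t" "F t \<le> Suc j * p"
        using unit_steps_mono[OF F(1), of "i j" t] unit_steps_mono[OF F(1), of t "i (Suc j)"]
          i[of j] i[of "Suc j"] j that by auto
      ultimately show ?thesis
        using zigzag_lap[OF assms(1), of "F t - j * p" j] assms(4)
        by (intro exI[of _ "F t - j * p"]) auto
    qed
    then obtain r where r: "\<And>t. t \<in> {i j..i (Suc j)} \<Longrightarrow>
        F t = j * p + r t \<and> f t = (if even j then r t else p - r t)"
      by metis
    have "r s \<le> r t" if "s \<in> {i j..i (Suc j)}" "t \<in> {i j..i (Suc j)}" "s \<le> t" for s t
    proof -
      have "t \<le> N" using that i[of "Suc j"] j by simp
      then have "F s \<le> F t" using unit_steps_mono[OF F(1)] that by blast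
      then show ?thesis using r that by simp
    qed
    then show ?thesis using r
      by (cases "even j") (auto simp: monotone_on_def intro!: diff_le_mono2)
  qed
  have "f (i j) = (if even j then 0 else p)" if "j \<le> k" for j
    using zigzag_lap[OF assms(1), of 0 j] i[OF that] assms(4) by simp
  then have "i 0 = 0 \<and> (\<forall>j<k. i j < i (Suc j)) \<and> i k = Suc N - 1 \<and>
     (\<forall>j<k. mono_on {i j..i (Suc j)} f \<or> antimono_on {i j..i (Suc j)} f) \<and>
     (\<forall>j\<le>k. odd j \<longrightarrow> f (i j) = Suc p - 1) \<and>
     (\<forall>j\<le>k. even j \<longrightarrow> f (i j) = 0)"
    using i[of 0] i[of k] less lap by simp
  then show ?thesis using zigzag_lift_epimorphism[OF assms] unfolding std_mor_def by blast
qed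

text \<open>
  The lift is the total variation of the morphism. On a lap, a monotone map moves away from the
  end at which the lap starts, so the variation in the lap is the distance from that end.
\<close>
lemma std_mor_zigzag_lift:
  assumes "p > 0" "N > 0" "f \<in> std_mor (Suc N) (Suc p)"
  obtains F where "lap_lift N p F" "\<And>i. i \<le> N \<Longrightarrow> f i = zigzag p (F i)"
proof -
  from assms(3) have epi: "f \<in> epimorphisms \<langle>Suc N\<rangle> \<langle>Suc p\<rangle>" by (simp add: std_mor_def)
  then have le: "f t \<le> p" if "t \<le> N" for t
    using that by (auto simp: epimorphisms_def)
  from epi have fstep: "f t \<le> Suc (f (Suc t)) \<and> f (Suc t) \<le> Suc (f t)" if "Suc t \<le> N" for t
  proof -
    have "(t, Suc t) \<in> edges \<langle>Suc N\<rangle>" using that by (simp add: edges_std)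
    then have "(f t, f (Suc t)) \<in> edges \<langle>Suc p\<rangle>" using epi by (auto simp: epimorphisms_def)
    then show ?thesis by (simp add: edges_std)
  qed
  from assms(3) obtain k i where i: "i 0 = 0" "\<And>j. j < k \<Longrightarrow> i j < i (Suc j)" "i k = N"
    and lap: "\<And>j. j < k \<Longrightarrow> mono_on {i j..i (Suc j)} f \<or> antimono_on {i j..i (Suc j)} f"
    and fi: "\<And>j. j \<le> k \<Longrightarrow> f (i j) = (if even j then 0 else p)"
    unfolding std_mor_def by fastforce
  have iN: "i j \<le> N" if "j \<le> k" for j
    using that
  proof (induction j rule: inc_induct)
    case (step j)
    then show ?case using i(2)[of j] by simp
  qed (simp add: i(3))
  define F where "F t = (\<Sum>s<t. if f (Suc s) = f s then 0 else 1 :: nat)" for t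
  have F0: "F 0 = 0" and FS: "F (Suc t) = F t + (if f (Suc t) = f t then 0 else 1)" for t
    by (auto simp: F_def)
  have F: "unit_steps N F" by (auto simp: unit_steps_def F0 FS)
  have height: "F t = j * p + (if even j then f t else p - f t)"
    if j: "j < k" and start: "F (i j) = j * p" and t: "i j \<le> t" "t \<le> i (Suc j)" for j t
    using t
  proof (induction t rule: dec_induct)
    case base
    then show ?case using start fi[of j] j by simp
  next
    case (step t)
    have tN: "Suc t \<le> N" using step iN[of "Suc j"] j by simp
    have ends: "i j \<in> {i j..i (Suc j)}" "i (Suc j) \<in> {i j..i (Suc j)}" "i j \<le> i (Suc j)"
      using i(2)[OF j] by auto
    have "\<not> antimono_on {i j..i (Suc j)} f" if "even j"
      using monotone_onD[of "{i j..i (Suc j)}" "(\<le>)" "(\<ge>)" f, OF _ ends] fi[of j] fi[of "Suc j"] j assms(1) that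
      by auto
    moreover have "\<not> mono_on {i j..i (Suc j)} f" if "odd j"
      using monotone_onD[of "{i j..i (Suc j)}" "(\<le>)" "(\<le>)" f, OF _ ends] fi[of j] fi[of "Suc j"] j assms(1) that
      by auto
    ultimately have "if even j then mono_on {i j..i (Suc j)} f else antimono_on {i j..i (Suc j)} f"
      using lap[OF j] by auto
    then have "if even j then f t \<le> f (Suc t) else f (Suc t) \<le> f t"
      using step by (auto simp: monotone_on_def split: if_splits)
    then show ?case
      using step.IH[OF Suc_leD[OF step.prems]] fstep[OF tN] le[of t] le[of "Suc t"] tN FS[of t] by (auto split: if_splits)
  qed
  have start: "F (i j) = j * p" if "j \<le> k" for j
    using that
  proof (induction j)
    case 0
    then show ?case by (simp add: i(1) F0)
  next
    case (Suc j)
    then show ?case using height[of j "i (Suc j)"] i(2)[of j] fi[of "Suc j"] by auto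
  qed
  have k: "k > 0" using i(1,3) assms(2) by (cases k) auto
  have cover: "\<exists>j'<j. i j' \<le> t \<and> t \<le> i (Suc j')" if "0 < j" "j \<le> k" "t \<le> i j" for j t
    using that
  proof (induction j)
    case (Suc j)
    show ?case
    proof (cases "t \<le> i j \<and> j > 0")
      case True
      then show ?thesis using Suc by (metis Suc_leD less_SucI)
    next
      case False
      then have "i j \<le> t" using i(1) by (cases j) auto
      then show ?thesis using Suc.prems by blast
    qed
  qed simp
  have "f t = zigzag p (F t)" if t: "t \<le> N" for t
  proof -
    obtain j where j: "j < k" "i j \<le> t" "t \<le> i (Suc j)" using cover[of k t] k i(3) t by auto
    then have "F t = j * p + (if even j then f t else p - f t)" using height start by simp
    then show ?thesis
      using zigzag_lap[OF assms(1), of "if even j then f t else p - f t" j] le[OF t] by auto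
  qed
  moreover have "lap_lift N p F" using F start[of k] i(3) k by (auto simp: lap_lift_def)
  ultimately show ?thesis using that by blast
qed

section \<open>Transport along isomorphisms\<close>

text \<open>
  A path with a marked end is rigid: the image of the vertex $i$ must be a neighbour of the image
  of $i - 1$ that has not been visited yet, and there is only one.
\<close>
lemma graph_iso_std_unique:
  assumes "graph_iso \<langle>Suc N\<rangle> A a" "graph_iso \<langle>Suc N'\<rangle> A a'"
  shows "N = N'" "\<And>i. i \<le> N \<Longrightarrow> a i = a' i"
proof -
  have bij: "bij_betw a {..N} (verts A)" "bij_betw a' {..N'} (verts A)"
    using assms by (auto simp: graph_iso_def)
  show N: "N = N'" using bij_betw_same_card[OF bij(1)] bij_betw_same_card[OF bij(2)] by simp
  fix i assume "i \<le> N"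
  then show "a i = a' i"
  proof (induction i rule: less_induct)
    case (less i)
    show ?case
    proof (cases i)
      case 0
      then show ?thesis using assms by (auto simp: graph_iso_def)
    next
      case (Suc h)
      have "(h, i) \<in> edges \<langle>Suc N\<rangle>" using Suc less.prems by (simp add: edges_std)
      then have "(a h, a i) \<in> edges A" using assms(1) by (force simp: graph_iso_def)
      then obtain x y where xy: "(x, y) \<in> edges \<langle>Suc N\<rangle>" "a h = a' x" "a i = a' y"
        using assms(2) N by (force simp: graph_iso_def)
      have le: "x \<le> N" "y \<le> N" "y \<le> Suc x" using xy(1) by (auto simp: edges_std)
      have "a' h = a' x" using less Suc xy(2) by simp
      then have "x = h"
        using bij(2) le N less.prems Suc by (auto simp: bij_betw_def inj_on_def)
      then have "y \<le> i" using le Suc by simp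
      moreover have False if "y < i"
      proof -
        have "a y = a i" using less.IH[of y] that le xy(3) by simp
        then show False using bij(1) le less.prems that by (auto simp: bij_betw_def inj_on_def)
      qed
      ultimately show ?thesis using xy(3) by (cases "y = i") auto
    qed
  qed
qed

lemma epimorphism_transport:
  assumes A: "graph_iso X A a" and B: "graph_iso Y B b" and g: "g \<in> epimorphisms X Y"
    and X: "edges X \<subseteq> verts X \<times> verts X" "zero_vertex X \<in> verts X"
    and f: "f \<in> extensional (verts A)" "\<And>x. x \<in> verts X \<Longrightarrow> f (a x) = b (g x)"
  shows "f \<in> epimorphisms A B"
proof -
  have A': "verts A = a ` verts X" "edges A = map_prod a a ` edges X" "zero_vertex A = a (zero_vertex X)"
    and B': "verts B = b ` verts Y" "edges B = map_prod b b ` edges Y" "zero_vertex B = b (zero_vertex Y)"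
    using A B by (auto simp: graph_iso_def bij_betw_def)
  have g': "g ` verts X = verts Y" "g (zero_vertex X) = zero_vertex Y"
    "\<And>x y. (x, y) \<in> edges X \<Longrightarrow> (g x, g y) \<in> edges Y"
    "\<And>u v. (u, v) \<in> edges Y \<Longrightarrow> \<exists>x y. (x, y) \<in> edges X \<and> g x = u \<and> g y = v"
    using g by (fastforce simp: epimorphisms_def)+
  have img: "f ` verts A = verts B"
    unfolding A' B' g'(1)[symmetric] image_image using f(2) by (intro image_cong) auto
  moreover have "f (zero_vertex A) = zero_vertex B" using A' B' g' f X by simp
  moreover have "\<forall>(x, y)\<in>edges A. (f x, f y) \<in> edges B"
  proof clarify
    fix x y assume "(x, y) \<in> edges A"
    then obtain s t where st: "(s, t) \<in> edges X" "x = a s" "y = a t" by (auto simp: A')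
    then have "f x = b (g s)" "f y = b (g t)" using X f(2) by auto
    then show "(f x, f y) \<in> edges B" using g'(3)[OF st(1)] by (force simp: B')
  qed
  moreover have "\<forall>(u, v)\<in>edges B. \<exists>(x, y)\<in>edges A. f x = u \<and> f y = v"
  proof clarify
    fix u v assume "(u, v) \<in> edges B"
    then obtain u' v' where "(u', v') \<in> edges Y" "u = b u'" "v = b v'" by (auto simp: B')
    moreover from this obtain s t where st: "(s, t) \<in> edges X" "g s = u'" "g t = v'"
      using g'(4) by blast
    moreover from st have "f (a s) = b u'" "f (a t) = b v'" using X f(2) by auto
    ultimately show "\<exists>(x, y)\<in>edges A. f x = u \<and> f y = v" by (force simp: A')
  qed
  ultimately show ?thesis using f(1) by (auto simp: epimorphisms_def PiE_def)
qed

text \<open>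
  The definition of a morphism allows any pair of coordinates on the two graphs. By rigidity
  any fixed pair will do, so that morphisms with a common source or target can be
  compared in the same coordinates.
\<close>
lemma K_mor_iff:
  assumes "N > 0" "p > 0" "graph_iso \<langle>Suc N\<rangle> A a" "graph_iso \<langle>Suc p\<rangle> B b"
  shows "f \<in> K_mor A B \<longleftrightarrow> f \<in> extensional (verts A) \<and>
    (\<exists>F. lap_lift N p F \<and> (\<forall>i\<le>N. f (a i) = b (zigzag p (F i))))"
proof
  assume f: "f \<in> K_mor A B"
  then obtain n m a' b' g where g: "n \<ge> 2" "m \<ge> 2" "graph_iso \<langle>n\<rangle> A a'" "graph_iso \<langle>m\<rangle> B b'"
    "g \<in> std_mor n m" "\<forall>i<n. f (a' i) = b' (g i)"
    by (auto simp: K_mor_def)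
  obtain N' p' where np: "n = Suc N'" "m = Suc p'" using g(1,2) by (metis Suc_le_D numeral_2_eq_2)
  have "N' = N" "p' = p" and eq: "\<And>i. i \<le> N \<Longrightarrow> a i = a' i" "\<And>i. i \<le> p \<Longrightarrow> b i = b' i"
    using graph_iso_std_unique[OF assms(3) g(3)[unfolded np]]
      graph_iso_std_unique[OF assms(4) g(4)[unfolded np]] by auto
  then have np: "n = Suc N" "m = Suc p" using np by auto
  obtain F where F: "lap_lift N p F" "\<And>i. i \<le> N \<Longrightarrow> g i = zigzag p (F i)"
    using std_mor_zigzag_lift[OF assms(2,1) g(5)[unfolded np]] by blast
  have "f (a i) = b (zigzag p (F i))" if "i \<le> N" for i
    using g(6) np eq F(2) that zigzag_le[OF assms(2)] by (metis le_imp_less_Suc)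
  moreover have "f \<in> extensional (verts A)"
    using f by (auto simp: K_mor_def epimorphisms_def PiE_def)
  ultimately show "f \<in> extensional (verts A) \<and>
    (\<exists>F. lap_lift N p F \<and> (\<forall>i\<le>N. f (a i) = b (zigzag p (F i))))" using F(1) by blast
next
  assume "f \<in> extensional (verts A) \<and>
    (\<exists>F. lap_lift N p F \<and> (\<forall>i\<le>N. f (a i) = b (zigzag p (F i))))"
  then obtain F where f: "f \<in> extensional (verts A)" "lap_lift N p F"
    "\<And>i. i \<le> N \<Longrightarrow> f (a i) = b (zigzag p (F i))" by blast
  define g where "g = (\<lambda>i\<in>{..N}. zigzag p (F i))"
  have g: "g \<in> std_mor (Suc N) (Suc p)"
    using zigzag_lift_std_mor[OF assms(2) f(2), of g] by (simp add: g_def)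
  have fg: "f (a i) = b (g i)" if "i \<le> N" for i using f(3) that by (simp add: g_def)
  have "g \<in> epimorphisms \<langle>Suc N\<rangle> \<langle>Suc p\<rangle>" using g by (simp add: std_mor_def)
  from epimorphism_transport[OF assms(3,4) this edges_std_subset _ f(1)] have "f \<in> epimorphisms A B"
    using fg by auto
  moreover have "Suc N \<ge> 2" "Suc p \<ge> 2" "\<forall>i<Suc N. f (a i) = b (g i)" using assms fg by auto
  ultimately show "f \<in> K_mor A B" unfolding K_mor_def using assms(3,4) g by blast
qed

lemma K_obj_iso:
  assumes "A \<in> K_obj"
  obtains N a where "N > 0" "graph_iso \<langle>Suc N\<rangle> A a" "bij_betw a {..N} (verts A)"
proof -
  obtain n a where n: "n \<ge> 2" "graph_iso \<langle>n\<rangle> A a"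
    using assms by (auto simp: K_obj_def graph_isomorphic_def)
  then obtain N where "n = Suc N" by (metis Suc_le_D numeral_2_eq_2)
  then show ?thesis using that[of N a] n by (auto simp: graph_iso_def)
qed

lemma std_copy:
  assumes "infinite (UNIV :: 'v set)"
  shows "\<exists>A :: 'v pgraph. \<exists>a. graph_iso \<langle>n\<rangle> A a"
proof -
  obtain a :: "nat \<Rightarrow> 'v" where "inj a" using infinite_countable_subset[OF assms] by blast
  then have "graph_iso \<langle>n\<rangle> \<lparr>verts = a ` verts \<langle>n\<rangle>, edges = map_prod a a ` edges \<langle>n\<rangle>, zero_vertex = a 0\<rparr> a"
    by (auto simp: graph_iso_def bij_betw_def inj_on_def)
  then show ?thesis by blast
qed

lemma std_copy_K_obj:
  assumes "infinite (UNIV :: 'v set)" "N > 0"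
  obtains A :: "'v pgraph" and a where "A \<in> K_obj" "graph_iso \<langle>Suc N\<rangle> A a" "bij_betw a {..N} (verts A)"
proof -
  obtain A :: "'v pgraph" and a where a: "graph_iso \<langle>Suc N\<rangle> A a" using std_copy[OF assms(1)] by blast
  moreover have "Suc N \<ge> 2" using assms(2) by simp
  ultimately have "A \<in> K_obj" unfolding K_obj_def graph_isomorphic_def by blast
  then show ?thesis using that a by (auto simp: graph_iso_def)
qed

lemma graph_isomorphic_common:
  assumes "graph_iso X A a" "graph_iso X B b"
    and X: "edges X \<subseteq> verts X \<times> verts X" "zero_vertex X \<in> verts X"
  shows "graph_isomorphic A B"
proof -
  let ?i = "the_inv_into (verts X) a"
  let ?h = "b \<circ> ?i"
  have inj: "inj_on a (verts X)" using assms(1) by (simp add: graph_iso_def bij_betw_def)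
  then have inv: "?i (a x) = x" if "x \<in> verts X" for x
    using that by (simp add: the_inv_into_f_f)
  have "bij_betw ?h (verts A) (verts B)"
    using bij_betw_trans[OF bij_betw_the_inv_into[of a "verts X" "verts A"], of b "verts B"] assms(1,2)
    by (simp add: graph_iso_def)
  moreover have "map_prod ?h ?h ` edges A = edges B"
  proof -
    have A: "edges A = map_prod a a ` edges X" using assms(1) unfolding graph_iso_def by metis
    have "map_prod ?h ?h ` edges A = (\<lambda>e. map_prod ?h ?h (map_prod a a e)) ` edges X"
      by (simp only: A image_image)
    also have "\<dots> = map_prod b b ` edges X"
    proof (rule image_cong)
      fix e assume "e \<in> edges X"
      then show "map_prod ?h ?h (map_prod a a e) = map_prod b b e"
        using X(1) inv by (cases e) auto
    qed simp
    finally show ?thesis using assms(2) by (simp add: graph_iso_def)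
  qed
  moreover have "?h (zero_vertex A) = zero_vertex B"
    using assms(1,2) inv[OF X(2)] unfolding graph_iso_def comp_apply by metis
  ultimately show ?thesis by (auto simp: graph_isomorphic_def graph_iso_def)
qed

lemma K_obj_countable_representatives:
  assumes "infinite (UNIV :: 'v set)"
  shows "\<exists>S\<subseteq>(K_obj :: 'v pgraph set). countable S \<and> (\<forall>A\<in>K_obj. \<exists>B\<in>S. graph_isomorphic A B)"
proof -
  obtain s :: "nat \<Rightarrow> 'v pgraph" where s: "\<And>n. \<exists>a. graph_iso \<langle>n\<rangle> (s n) a"
    using std_copy[OF assms] by metis
  have "s ` {2..} \<subseteq> K_obj" using s by (auto simp: K_obj_def graph_isomorphic_def)
  moreover have "countable (s ` {2..})" by simp
  moreover have "\<exists>B\<in>s ` {2..}. graph_isomorphic A B" if A: "A \<in> K_obj" for A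
  proof -
    obtain N a where a: "N > 0" "graph_iso \<langle>Suc N\<rangle> A a" using K_obj_iso[OF A] by blast
    obtain b where "graph_iso \<langle>Suc N\<rangle> (s (Suc N)) b" using s by blast
    from graph_isomorphic_common[OF a(2) this edges_std_subset]
    have "graph_isomorphic A (s (Suc N))" by simp
    then show ?thesis using a(1) by auto
  qed
  ultimately show ?thesis by blast
qed

section \<open>The projective Fraisse family\<close>

lemma K_mor_subset: "K_mor A B \<subseteq> verts A \<rightarrow>\<^sub>E verts B"
  by (auto simp: K_mor_def epimorphisms_def)

lemma lap_lift_id: "0 < k \<Longrightarrow> N = k * p \<Longrightarrow> lap_lift N p (\<lambda>i. i)"
  by (auto simp: lap_lift_def unit_steps_def)

lemma K_mor_id:
  assumes "A \<in> K_obj"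
  shows "(\<lambda>x\<in>verts A. x) \<in> K_mor A A"
proof -
  obtain N a where a: "N > 0" "graph_iso \<langle>Suc N\<rangle> A a" "bij_betw a {..N} (verts A)"
    using K_obj_iso[OF assms] by blast
  have "(\<lambda>x\<in>verts A. x) (a i) = a (zigzag N i)" if "i \<le> N" for i
    using bij_betwE[OF a(3)] that by (simp add: zigzag_id)
  moreover have "lap_lift N N (\<lambda>i. i)" using lap_lift_id[of 1 N N] by simp
  ultimately show ?thesis
    unfolding K_mor_iff[OF a(1,1,2,2)] by (metis restrict_extensional)
qed

lemma K_mor_compose:
  assumes "A \<in> K_obj" "B \<in> K_obj" "C \<in> K_obj" "f \<in> K_mor A B" "g \<in> K_mor B C"
  shows "compose (verts A) g f \<in> K_mor A C"
proof -
  obtain N a where a: "N > 0" "graph_iso \<langle>Suc N\<rangle> A a" "bij_betw a {..N} (verts A)"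
    using K_obj_iso[OF assms(1)] by blast
  obtain p b where b: "p > 0" "graph_iso \<langle>Suc p\<rangle> B b" using K_obj_iso[OF assms(2)] by blast
  obtain q c where c: "q > 0" "graph_iso \<langle>Suc q\<rangle> C c" using K_obj_iso[OF assms(3)] by blast
  obtain F where F: "lap_lift N p F" "\<And>i. i \<le> N \<Longrightarrow> f (a i) = b (zigzag p (F i))"
    using assms(4) K_mor_iff[OF a(1) b(1) a(2) b(2)] by blast
  obtain G where G: "lap_lift p q G" "\<And>i. i \<le> p \<Longrightarrow> g (b i) = c (zigzag q (G i))"
    using assms(5) K_mor_iff[OF b(1) c(1) b(2) c(2)] by blast
  obtain H where H: "lap_lift N q H" "\<And>i. zigzag q (H i) = zigzag q (G (zigzag p (F i)))"
    using lap_lift_comp[OF b(1) c(1) F(1) G(1)] by blast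
  have "compose (verts A) g f (a i) = c (zigzag q (H i))" if "i \<le> N" for i
  proof -
    have "a i \<in> verts A" using a(3) that by (auto simp: bij_betw_def)
    then show ?thesis using F(2)[OF that] G(2) H(2) zigzag_le[OF b(1)] by (simp add: compose_def)
  qed
  then show ?thesis
    using K_mor_iff[OF a(1) c(1) a(2) c(2)] H(1) by (auto simp: compose_def)
qed

lemma K_mor_amalgamation:
  assumes "infinite (UNIV :: 'v set)"
    and "A \<in> K_obj" "B \<in> K_obj" "C \<in> (K_obj :: 'v pgraph set)" "f \<in> K_mor B A" "g \<in> K_mor C A"
  shows "\<exists>D\<in>K_obj. \<exists>f'\<in>K_mor D B. \<exists>g'\<in>K_mor D C. compose (verts D) f f' = compose (verts D) g g'"
proof -
  obtain p a where a: "p > 0" "graph_iso \<langle>Suc p\<rangle> A a" using K_obj_iso[OF assms(2)] by blast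
  obtain m b where b: "m > 0" "graph_iso \<langle>Suc m\<rangle> B b" using K_obj_iso[OF assms(3)] by blast
  obtain n c where c: "n > 0" "graph_iso \<langle>Suc n\<rangle> C c" using K_obj_iso[OF assms(4)] by blast
  obtain F where F: "lap_lift m p F" "\<And>i. i \<le> m \<Longrightarrow> f (b i) = a (zigzag p (F i))"
    using assms(5) K_mor_iff[OF b(1) a(1) b(2) a(2)] by blast
  obtain G where G: "lap_lift n p G" "\<And>i. i \<le> n \<Longrightarrow> g (c i) = a (zigzag p (G i))"
    using assms(6) K_mor_iff[OF c(1) a(1) c(2) a(2)] by blast
  obtain N U V where UV: "N > 0" "lap_lift N m U" "lap_lift N n V"
    "\<And>i. i \<le> N \<Longrightarrow> zigzag p (F (zigzag m (U i))) = zigzag p (G (zigzag n (V i)))"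
    using lap_lift_amalgamation[OF a(1) b(1) c(1) F(1) G(1)] by metis
  obtain D :: "'v pgraph" and d where d: "D \<in> K_obj" "graph_iso \<langle>Suc N\<rangle> D d" "bij_betw d {..N} (verts D)"
    using std_copy_K_obj[OF assms(1) UV(1)] .
  let ?i = "the_inv_into {..N} d"
  have inv: "?i (d i) = i" "d i \<in> verts D" if "i \<le> N" for i
    using d(3) that by (auto simp: bij_betw_def the_inv_into_f_f)
  define f' where "f' = (\<lambda>x\<in>verts D. b (zigzag m (U (?i x))))"
  define g' where "g' = (\<lambda>x\<in>verts D. c (zigzag n (V (?i x))))"
  have "f' \<in> K_mor D B"
    unfolding K_mor_iff[OF UV(1) b(1) d(2) b(2)] using UV(2) inv by (auto simp: f'_def)
  moreover have "g' \<in> K_mor D C"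
    unfolding K_mor_iff[OF UV(1) c(1) d(2) c(2)] using UV(3) inv by (auto simp: g'_def)
  moreover have "compose (verts D) f f' = compose (verts D) g g'"
  proof (rule extensionalityI)
    fix x assume "x \<in> verts D"
    then obtain i where i: "i \<le> N" "x = d i" using d(3) by (auto simp: bij_betw_def)
    show "compose (verts D) f f' x = compose (verts D) g g' x"
      using UV(4)[OF i(1)] F(2)[OF zigzag_le[OF b(1)]] G(2)[OF zigzag_le[OF c(1)]] inv[OF i(1)] i(2)
      by (simp add: compose_def f'_def g'_def)
  qed (auto simp: compose_def)
  ultimately show ?thesis using d(1) by blast
qed

text \<open>
  Reading vertices modulo $2$ turns every step of the source into a lap over a single edge.
\<close>
lemma K_mor_to_edge:
  assumes "A \<in> K_obj" "graph_iso \<langle>Suc 1\<rangle> E e"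
  shows "K_mor A E \<noteq> {}"
proof -
  obtain N a where a: "N > 0" "graph_iso \<langle>Suc N\<rangle> A a" "bij_betw a {..N} (verts A)"
    using K_obj_iso[OF assms(1)] by blast
  let ?f = "\<lambda>x\<in>verts A. e (zigzag 1 (the_inv_into {..N} a x))"
  have "\<forall>i\<le>N. ?f (a i) = e (zigzag 1 i)"
    using a(3) by (auto simp: bij_betw_def the_inv_into_f_f)
  then have "?f \<in> K_mor A E"
    using K_mor_iff[OF a(1) _ a(2) assms(2)] lap_lift_id[of N N 1] a(1) by auto
  then show ?thesis by blast
qed

theorem theorem3p2:
  assumes "infinite (UNIV :: 'v set)"
  shows "projective_Fraisse_family verts graph_isomorphic (K_obj :: 'v pgraph set) K_mor"
proof -
  \<comment> \<open>Joint projection is amalgamation over the path with a single edge.\<close>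
  obtain E :: "'v pgraph" and e where E: "E \<in> K_obj" "graph_iso \<langle>Suc 1\<rangle> E e"
    using std_copy_K_obj[OF assms zero_less_one] by blast
  have "\<exists>C\<in>K_obj. K_mor C A \<noteq> {} \<and> K_mor C B \<noteq> {}"
    if AB: "A \<in> K_obj" "B \<in> K_obj" for A B :: "'v pgraph"
  proof -
    obtain f g where "f \<in> K_mor A E" "g \<in> K_mor B E"
      using K_mor_to_edge[OF AB(1) E(2)] K_mor_to_edge[OF AB(2) E(2)] by blast
    then show ?thesis using K_mor_amalgamation[OF assms E(1) AB] by blast
  qed
  moreover have "finite (verts A)" if "A \<in> K_obj" for A :: "'v pgraph"
    using K_obj_iso[OF that] bij_betw_finite by (metis finite_atMost)
  ultimately show ?thesis
    unfolding projective_Fraisse_family_def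
    by (intro conjI ballI K_mor_subset K_mor_compose K_mor_id
        K_obj_countable_representatives[OF assms] K_mor_amalgamation[OF assms]) simp_all
qed

end
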